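(* Let $p\ge 1$ and let $S\subseteq\mathbb{R}^p$ be a (possibly infinite) set. Then for any integer $k\ge 1$, $S$ is weakly $k$-neighborly if and only if every finite subset of $S$ is weakly $k$-neighborly.
   Context: A set $S\subseteq\mathbb{R}^p$ is weakly $k$-neighborly if for any set $T$ of $k$ points from $S$ there exists a closed halfspace $H$ with boundary $\operatorname{bd}(H)$ such that $S\subset H$ and $T\subset\operatorname{bd}(H)$. *)

theory Defs
  imports "HOL-Analysis.Analysis"
begin

(* The normal a is nonzero: otherwise the empty set and the whole space,
   whose boundaries are empty, would also be of this form. *)
definition closed_halfspace :: "'a::euclidean_space set \<Rightarrow> bool" where
  "closed_halfspace H \<longleftrightarrow> (\<exists>a b. a \<noteq> 0 \<and> H = {x. a \<bullet> x \<le> b})"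

(* T ranges over sets of exactly k distinct points, so a set with fewer than
   k points is vacuously weakly k-neighborly. *)
definition weakly_neighborly :: "nat \<Rightarrow> 'a::euclidean_space set \<Rightarrow> bool" where
  "weakly_neighborly k S \<longleftrightarrow>
     (\<forall>T. T \<subseteq> S \<and> finite T \<and> card T = k \<longrightarrow>
        (\<exists>H. closed_halfspace H \<and> S \<subseteq> H \<and> T \<subseteq> frontier H))"

end

theory Submission
  imports Defs
begin

text \<open>A closed halfspace supporting S along T is the same thing as a unit normal a such that every
  point of T maximises the functional a on S. For each x in S this is a closed condition on a, so
  compactness of the unit sphere (finite intersection property) yields a common normal for all of S
  as soon as each finite subset of S containing T admits one.\<close>

text \<open>The offset can be eliminated: the frontier of \<open>{x. a \<bullet> x \<le> b}\<close>
  is the hyperplane \<open>a \<bullet> x = b\<close>, so \<open>b\<close> is the common value of the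
  functional on the nonempty set \<open>T\<close>.\<close>

lemma supporting_halfspace_iff_unit_normal:
  fixes S T :: "'a::euclidean_space set"
  assumes "T \<subseteq> S" "T \<noteq> {}"
  shows "(\<exists>H. closed_halfspace H \<and> S \<subseteq> H \<and> T \<subseteq> frontier H) \<longleftrightarrow>
         (\<exists>a \<in> sphere 0 1. \<forall>x\<in>S. \<forall>t\<in>T. a \<bullet> x \<le> a \<bullet> t)"
proof
  assume "\<exists>H. closed_halfspace H \<and> S \<subseteq> H \<and> T \<subseteq> frontier H"
  then obtain a b where a: "a \<noteq> 0" and S: "S \<subseteq> {x. a \<bullet> x \<le> b}"
    and "T \<subseteq> frontier {x. a \<bullet> x \<le> b}"
    by (auto simp: closed_halfspace_def)
  then have T: "T \<subseteq> {x. a \<bullet> x = b}"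
    by (simp add: frontier_halfspace_le)
  \<comment> \<open>\<open>sgn a\<close> is \<open>a\<close> scaled by the positive factor
    \<open>1 / norm a\<close>, which preserves the inequalities.\<close>
  have "\<forall>x\<in>S. \<forall>t\<in>T. sgn a \<bullet> x \<le> sgn a \<bullet> t"
    using S T by (auto simp: sgn_div_norm intro!: mult_left_mono)
  moreover have "sgn a \<in> sphere 0 1"
    using a by (simp add: norm_sgn)
  ultimately show "\<exists>a \<in> sphere 0 1. \<forall>x\<in>S. \<forall>t\<in>T. a \<bullet> x \<le> a \<bullet> t" ..
next
  assume "\<exists>a \<in> sphere 0 1. \<forall>x\<in>S. \<forall>t\<in>T. a \<bullet> x \<le> a \<bullet> t"
  then obtain a :: 'a where "norm a = 1" and le: "\<And>x t. x \<in> S \<Longrightarrow> t \<in> T \<Longrightarrow> a \<bullet> x \<le> a \<bullet> t"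
    by auto
  then have a: "a \<noteq> 0" by auto
  obtain u where u: "u \<in> T" using assms by blast
  let ?H = "{x. a \<bullet> x \<le> a \<bullet> u}"
  have "closed_halfspace ?H"
    using a by (auto simp: closed_halfspace_def)
  moreover have "S \<subseteq> ?H"
    using le u by blast
  \<comment> \<open>Since \<open>T \<subseteq> S\<close>, \<open>le\<close> applies to
    \<open>u\<close> and any \<open>t\<close> in \<open>T\<close> in both orders, so the functional
    is constant on \<open>T\<close>.\<close>
  moreover have "T \<subseteq> frontier ?H"
    using a le u assms(1) by (auto simp: frontier_halfspace_le intro: order_antisym)
  ultimately show "\<exists>H. closed_halfspace H \<and> S \<subseteq> H \<and> T \<subseteq> frontier H"
    by blast
qed

lemma weakly_neighborly_subset:
  assumes "weakly_neighborly k S" "F \<subseteq> S"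
  shows "weakly_neighborly k F"
  using assms unfolding weakly_neighborly_def by (metis order_trans)

theorem proposition4p22:
  fixes S :: "(real ^ 'p) set" and k :: nat
  assumes "k \<ge> 1"
  shows "weakly_neighborly k S \<longleftrightarrow>
         (\<forall>F. F \<subseteq> S \<and> finite F \<longrightarrow> weakly_neighborly k F)"
proof
  assume "weakly_neighborly k S"
  then show "\<forall>F. F \<subseteq> S \<and> finite F \<longrightarrow> weakly_neighborly k F"
    by (blast intro: weakly_neighborly_subset)
next
  assume fin: "\<forall>F. F \<subseteq> S \<and> finite F \<longrightarrow> weakly_neighborly k F"
  show "weakly_neighborly k S"
    unfolding weakly_neighborly_def
  proof (intro allI impI)
    fix T assume T: "T \<subseteq> S \<and> finite T \<and> card T = k"
    \<comment> \<open>Here \<open>k \<ge> 1\<close> enters. For \<open>k = 0\<close> the claim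
      fails: the whole space lies in no closed halfspace, but each finite set does.\<close>
    then have "T \<noteq> {}" using assms by auto
    let ?N = "\<lambda>x. {a. \<forall>t\<in>T. a \<bullet> x \<le> a \<bullet> t}"
    have "sphere 0 1 \<inter> (\<Inter>x\<in>S. ?N x) \<noteq> {}"
    proof (rule compact_imp_fip_image)
      show "closed (?N x)" for x
        by (auto simp: Collect_ball_eq intro!: closed_INT closed_Collect_le continuous_intros)
      fix G assume G: "finite G" "G \<subseteq> S"
      \<comment> \<open>Adjoining \<open>T\<close> to \<open>G\<close> keeps the set finite and
        makes \<open>T\<close> one of its \<open>k\<close>-point subsets.\<close>
      with T fin have "weakly_neighborly k (T \<union> G)" by simp
      with T have "\<exists>H. closed_halfspace H \<and> T \<union> G \<subseteq> H \<and> T \<subseteq> frontier H"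
        unfolding weakly_neighborly_def by blast
      then show "sphere 0 1 \<inter> (\<Inter>x\<in>G. ?N x) \<noteq> {}"
        using supporting_halfspace_iff_unit_normal[of T "T \<union> G"] \<open>T \<noteq> {}\<close> by blast
    \<comment> \<open>What remains is compactness of the unit sphere.\<close>
    qed simp
    then show "\<exists>H. closed_halfspace H \<and> S \<subseteq> H \<and> T \<subseteq> frontier H"
      using supporting_halfspace_iff_unit_normal[of T S] \<open>T \<noteq> {}\<close> T by blast
  qed
qed

end
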